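(* Let $(V,V^+)$ be an ordered $*$-vector space with Archimedean order unit $e$, and assume $V\neq\{0\}$. Give $V$ the order topology, and endow the state space $S(V) := \{ f: V \to \mathbb{C} : f \text{ is a state} \}$ with the corresponding weak-$*$ topology. Then $S(V)$ is a compact space, and the map $\Phi : V \to C(S(V))$ given by $\Phi(v)(f) := f(v)$ is an injective map that is an order isomorphism onto its range with the property that $\Phi(e) = 1$. Furthermore, $\Phi$ is an isometry with respect to the minimal order norm on $V$ and the sup norm on $C(S(V))$.
   Context: A $*$-vector space is a complex vector space $V$ with a conjugate-linear involution $*:V\to V$; $V_h:=\{x\in V: x^*=x\}$. An ordered $*$-vector space $(V,V^+)$ is a $*$-vector space $V$ with a nonempty subset $V^+\subseteq V_h$ closed under addition and under multiplication by scalars in $[0,\infty)$, such that $V^+\cap -V^+=\{0\}$. For $v,w\in V_h$ write $v\ge w$ if $v-w\in V^+$. An element $e\in V_h$ is an order unit if for every $x\in V_h$ there is a real $r>0$ with $re\ge x$; it is Archimedean if, in addition, whenever $x\in V_h$ and $re+x\ge0$ for all real $r>0$, then $x\ge 0$. A state on $V$ is a $\mathbb{C}$-linear functional $f:V\to\mathbb{C}$ with $f(V^+)\subseteq[0,\infty)$ and $f(e)=1$. The order norm on $V_h$ is $\|v\|:=\inf\{r\in\mathbb{R}: re+v\ge0\text{ and }re-v\ge0\}$. An order norm on $V$ is a norm $|||\cdot|||$ on $V$ with $|||v^*|||=|||v|||$ for all $v\in V$ and $|||v|||=\|v\|$ for $v\in V_h$; the minimal order norm is $\|v\|_m := \sup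 \{ |f(v)|: f:V \to \mathbb{C} \text{ is a state} \}$, which is one such. The order topology on $V$ is the topology generated by any order norm (all order norms are equivalent), e.g. by $\|\cdot\|_m$. States are continuous in this topology, so $S(V)$ is a subset of the topological dual $V^*$, and its weak-$*$ topology is the topology of pointwise convergence on $V$. For a compact Hausdorff space $X$, $C(X)$ is the space of continuous complex-valued functions on $X$, ordered by $C(X)^+=\{g: g(x)\ge 0\text{ for all }x\in X\}$, with involution complex conjugation and order unit the constant function $1$. "Order isomorphism onto its range" means that $\Phi$ is linear and bijective onto its range and $v\in V^+$ if and only if $\Phi(v)\in C(S(V))^+$. *)

theory Defs
  imports "HOL-Analysis.Analysis"
begin

locale star_vector_space = vector_space scl
  for scl :: "complex \<Rightarrow> 'v::ab_group_add \<Rightarrow> 'v" (infixr "*s" 75) +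
  fixes star :: "'v \<Rightarrow> 'v"
  assumes star_add: "star (x + y) = star x + star y"
    and star_scale: "star (c *s x) = cnj c *s star x"
    and star_star: "star (star x) = x"

definition hermitian :: "('v \<Rightarrow> 'v) \<Rightarrow> 'v set"
  where "hermitian star = {x. star x = x}"

locale ordered_star_vector_space = star_vector_space scl star
  for scl :: "complex \<Rightarrow> 'v::ab_group_add \<Rightarrow> 'v" (infixr "*s" 75)
    and star :: "'v \<Rightarrow> 'v" +
  fixes P :: "'v set"
  assumes P_nonempty: "P \<noteq> {}"
    and P_hermitian: "P \<subseteq> hermitian star"
    and P_add: "\<lbrakk>x \<in> P; y \<in> P\<rbrakk> \<Longrightarrow> x + y \<in> P"
    and P_scale: "\<lbrakk>r \<ge> 0; x \<in> P\<rbrakk> \<Longrightarrow> complex_of_real r *s x \<in> P"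
    and P_pointed: "P \<inter> uminus ` P = {0}"

definition order_unit ::
  "(complex \<Rightarrow> 'v::ab_group_add \<Rightarrow> 'v) \<Rightarrow> ('v \<Rightarrow> 'v) \<Rightarrow> 'v set \<Rightarrow> 'v \<Rightarrow> bool"
  where "order_unit scl star P e \<longleftrightarrow>
    e \<in> hermitian star \<and>
    (\<forall>x \<in> hermitian star. \<exists>r::real. r > 0 \<and> scl (complex_of_real r) e - x \<in> P)"

definition archimedean_order_unit ::
  "(complex \<Rightarrow> 'v::ab_group_add \<Rightarrow> 'v) \<Rightarrow> ('v \<Rightarrow> 'v) \<Rightarrow> 'v set \<Rightarrow> 'v \<Rightarrow> bool"
  where "archimedean_order_unit scl star P e \<longleftrightarrow>
    order_unit scl star P e \<and>
    (\<forall>x \<in> hermitian star.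
       (\<forall>r::real. r > 0 \<longrightarrow> scl (complex_of_real r) e + x \<in> P) \<longrightarrow> x \<in> P)"

definition state_space ::
  "(complex \<Rightarrow> 'v::ab_group_add \<Rightarrow> 'v) \<Rightarrow> 'v set \<Rightarrow> 'v \<Rightarrow> ('v \<Rightarrow> complex) set"
  where "state_space scl P e =
    {f. Vector_Spaces.linear scl (*) f \<and> f ` P \<subseteq> \<real>\<^sub>\<ge>\<^sub>0 \<and> f e = 1}"

definition min_order_norm ::
  "(complex \<Rightarrow> 'v::ab_group_add \<Rightarrow> 'v) \<Rightarrow> 'v set \<Rightarrow> 'v \<Rightarrow> 'v \<Rightarrow> real"
  where "min_order_norm scl P e v = (SUP f\<in>state_space scl P e. cmod (f v))"

text \<open>All order norms are equivalent, so the order topology may be generated by any one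
  of them; the minimal one is used here.\<close>

definition order_norm_topology ::
  "(complex \<Rightarrow> 'v::ab_group_add \<Rightarrow> 'v) \<Rightarrow> 'v set \<Rightarrow> 'v \<Rightarrow> 'v topology"
  where "order_norm_topology scl P e =
    Metric_space.mtopology UNIV (\<lambda>x y. min_order_norm scl P e (x - y))"

definition topological_dual ::
  "(complex \<Rightarrow> 'v::ab_group_add \<Rightarrow> 'v) \<Rightarrow> 'v topology \<Rightarrow> ('v \<Rightarrow> complex) set"
  where "topological_dual scl T =
    {f. Vector_Spaces.linear scl (*) f \<and> continuous_map T euclidean f}"

text \<open>The weak-* topology is the topology of pointwise convergence, that is, the one
  inherited from the product of copies of the complex plane indexed by the vectors.\<close>

definition weak_star_topology ::
  "(complex \<Rightarrow> 'v::ab_group_add \<Rightarrow> 'v) \<Rightarrow> 'v topology \<Rightarrow> ('v \<Rightarrow> complex) topology"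
  where "weak_star_topology scl T =
    subtopology (product_topology (\<lambda>_. euclidean) UNIV) (topological_dual scl T)"

definition state_topology ::
  "(complex \<Rightarrow> 'v::ab_group_add \<Rightarrow> 'v) \<Rightarrow> 'v set \<Rightarrow> 'v \<Rightarrow> ('v \<Rightarrow> complex) topology"
  where "state_topology scl P e =
    subtopology (weak_star_topology scl (order_norm_topology scl P e))
      (state_space scl P e)"

text \<open>Elements of \<open>C(X)\<close> are extensional, so that HOL equality of two of them is equality
  of functions on the underlying set of \<open>X\<close>.\<close>

definition C_space :: "'x topology \<Rightarrow> ('x \<Rightarrow> complex) set"
  where "C_space X = {g \<in> extensional (topspace X). continuous_map X euclidean g}"

definition C_pos :: "'x topology \<Rightarrow> ('x \<Rightarrow> complex) set"
  where "C_pos X = {g \<in> C_space X. \<forall>x \<in> topspace X. g x \<in> \<real>\<^sub>\<ge>\<^sub>0}"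

definition C_one :: "'x topology \<Rightarrow> 'x \<Rightarrow> complex"
  where "C_one X = (\<lambda>x\<in>topspace X. 1)"

definition sup_norm :: "'x topology \<Rightarrow> ('x \<Rightarrow> complex) \<Rightarrow> real"
  where "sup_norm X g = (SUP x\<in>topspace X. cmod (g x))"

definition linear_into_C ::
  "(complex \<Rightarrow> 'v::ab_group_add \<Rightarrow> 'v) \<Rightarrow> 'x topology \<Rightarrow> ('v \<Rightarrow> 'x \<Rightarrow> complex) \<Rightarrow> bool"
  where "linear_into_C scl X F \<longleftrightarrow>
    (\<forall>v w. F (v + w) = (\<lambda>x\<in>topspace X. F v x + F w x)) \<and>
    (\<forall>c v. F (scl c v) = (\<lambda>x\<in>topspace X. c * F v x))"

definition order_iso_onto_range ::
  "(complex \<Rightarrow> 'v::ab_group_add \<Rightarrow> 'v) \<Rightarrow> 'v set \<Rightarrow> 'x topology \<Rightarrow> ('v \<Rightarrow> 'x \<Rightarrow> complex) \<Rightarrow> bool"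
  where "order_iso_onto_range scl P X F \<longleftrightarrow>
    linear_into_C scl X F \<and> bij_betw F UNIV (range F) \<and> (\<forall>v. v \<in> P \<longleftrightarrow> F v \<in> C_pos X)"

text \<open>The evaluation map is restricted to states; on all functionals its injectivity
  would be trivial.\<close>

definition evaluation_map ::
  "(complex \<Rightarrow> 'v::ab_group_add \<Rightarrow> 'v) \<Rightarrow> 'v set \<Rightarrow> 'v \<Rightarrow> 'v \<Rightarrow> ('v \<Rightarrow> complex) \<Rightarrow> complex"
  where "evaluation_map scl P e v = (\<lambda>f\<in>state_space scl P e. f v)"

end

theory Submission
  imports Defs
begin

text \<open>
  Everything rests on one separation property: a vector \<open>v\<close> lies in the cone \<open>P\<close> as soon as
  \<open>f v \<ge> 0\<close> for every state \<open>f\<close> (lemma \<open>positive_iff_states\<close>).  It is obtained without a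
  dominated extension theorem.  If \<open>v\<close> is hermitian and not positive, the Archimedean property
  gives \<open>r > 0\<close> such that \<open>w = r e + v\<close> is still not positive.  Then the cone generated by \<open>P\<close>
  and \<open>- w\<close> does not contain \<open>- e\<close>, and Zorn's lemma enlarges it to a cone \<open>Q\<close> that is maximal
  among those avoiding \<open>- e\<close>.  Maximality makes the preorder defined by \<open>Q\<close> total, so that
  \<open>g x = Sup {t. x - t e \<in> Q}\<close> is additive and not just superadditive.  This \<open>g\<close> is a real
  state on the hermitian part with \<open>g w \<le> 0\<close>, that is, \<open>g v \<le> - r < 0\<close>, and it extends
  complex-linearly to a state on the whole space.

  Separation shows that \<open>\<Phi>\<close> is injective and reflects positivity, and that the minimal order norm
  is a norm.  States are therefore contractive for that norm, so they belong to the topological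
  dual.  For compactness, the state space is a subset of a product of discs \<open>{z. \<bar>z\<bar> \<le> \<parallel>v\<parallel>\<^sub>m}\<close>
  and is cut out of it by closed conditions on finitely many coordinates each.  The isometry
  statement is then the definition of the minimal order norm.
\<close>

section \<open>Hermitian vectors and the Cartesian decomposition\<close>

context ordered_star_vector_space
begin

(* The symbol *s also denotes the scalar multiplication of finite Cartesian products. *)
no_notation scl (infixr "*s" 75)
notation scl (infixr "\<cdot>" 75)

abbreviation rscale :: "real \<Rightarrow> 'v \<Rightarrow> 'v" (infixr "\<cdot>\<^sub>R" 75)
  where "r \<cdot>\<^sub>R x \<equiv> complex_of_real r \<cdot> x"

lemma star_zero [simp]: "star 0 = 0"
  using star_scale[of 0 0] by simp

lemma star_minus: "star (- x) = - star x"
  using star_scale[of "- 1" x] by simp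

lemma star_diff: "star (x - y) = star x - star y"
  using star_add[of x "- y"] by (simp add: star_minus)

lemma hermitian_closed:
  "0 \<in> hermitian star"
  "x \<in> hermitian star \<Longrightarrow> y \<in> hermitian star \<Longrightarrow> x + y \<in> hermitian star"
  "x \<in> hermitian star \<Longrightarrow> y \<in> hermitian star \<Longrightarrow> x - y \<in> hermitian star"
  "x \<in> hermitian star \<Longrightarrow> - x \<in> hermitian star"
  "x \<in> hermitian star \<Longrightarrow> r \<cdot>\<^sub>R x \<in> hermitian star"
  by (auto simp: hermitian_def star_add star_diff star_minus star_scale)

text \<open>The hermitian components \<open>a\<close>, \<open>b\<close> in the unique decomposition \<open>v = a + i b\<close>.\<close>

definition re_part :: "'v \<Rightarrow> 'v"
  where "re_part v = (1/2) \<cdot> (v + star v)"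

definition im_part :: "'v \<Rightarrow> 'v"
  where "im_part v = (- \<i>/2) \<cdot> (v - star v)"

lemma re_part_hermitian: "re_part v \<in> hermitian star"
  by (simp add: hermitian_def re_part_def star_scale star_add star_star add.commute)

lemma im_part_hermitian: "im_part v \<in> hermitian star"
  by (simp add: hermitian_def im_part_def star_scale star_diff star_star algebra_simps)

lemma cartesian_decomposition: "re_part v + \<i> \<cdot> im_part v = v"
proof -
  have "re_part v + \<i> \<cdot> im_part v = (1/2) \<cdot> v + (1/2) \<cdot> v"
    by (simp add: re_part_def im_part_def algebra_simps)
  also have "\<dots> = v"
    by (simp flip: scale_left_distrib)
  finally show ?thesis .
qed

lemma re_part_id: "x \<in> hermitian star \<Longrightarrow> re_part x = x"
  by (simp add: re_part_def hermitian_def scale_right_distrib flip: scale_left_distrib)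

lemma im_part_zero: "x \<in> hermitian star \<Longrightarrow> im_part x = 0"
  by (simp add: im_part_def hermitian_def)

lemma re_part_add: "re_part (v + w) = re_part v + re_part w"
  by (simp add: re_part_def star_add algebra_simps)

lemma im_part_add: "im_part (v + w) = im_part v + im_part w"
  by (simp add: im_part_def star_add algebra_simps)

lemma re_part_rscale: "re_part (r \<cdot>\<^sub>R v) = r \<cdot>\<^sub>R re_part v"
  by (simp add: re_part_def star_scale algebra_simps)

lemma im_part_rscale: "im_part (r \<cdot>\<^sub>R v) = r \<cdot>\<^sub>R im_part v"
  by (simp add: im_part_def star_scale algebra_simps)

lemma re_part_imult: "re_part (\<i> \<cdot> v) = - im_part v"
  by (simp add: re_part_def im_part_def star_scale algebra_simps)

lemma im_part_imult: "im_part (\<i> \<cdot> v) = re_part v"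
  by (simp add: re_part_def im_part_def star_scale algebra_simps)

text \<open>A real-linear functional on the hermitian part extends complex-linearly to the whole space.
  Only the values of \<open>g\<close> at hermitian vectors matter.\<close>

lemma complexification_linear:
  assumes add: "\<And>x y. x \<in> hermitian star \<Longrightarrow> y \<in> hermitian star \<Longrightarrow> g (x + y) = g x + g y"
    and scale: "\<And>r x. x \<in> hermitian star \<Longrightarrow> g (r \<cdot>\<^sub>R x) = r * g x"
  shows "Vector_Spaces.linear scl (*) (\<lambda>v. Complex (g (re_part v)) (g (im_part v)))"
    (is "Vector_Spaces.linear scl (*) ?f")
proof -
  have f_add: "?f (v + w) = ?f v + ?f w" for v w
    by (simp add: re_part_add im_part_add add re_part_hermitian im_part_hermitian complex_eq_iff)
  have f_rscale: "?f (r \<cdot>\<^sub>R v) = complex_of_real r * ?f v" for r v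
    by (simp add: re_part_rscale im_part_rscale scale re_part_hermitian im_part_hermitian
        complex_eq_iff)
  have g_minus: "g (- x) = - g x" if "x \<in> hermitian star" for x
    using scale[OF that, of "- 1"] by simp
  have f_imult: "?f (\<i> \<cdot> v) = \<i> * ?f v" for v
    by (simp add: re_part_imult im_part_imult g_minus im_part_hermitian complex_eq_iff)
  have f_scale: "?f (c \<cdot> v) = c * ?f v" for c v
  proof -
    have "c \<cdot> v = Re c \<cdot>\<^sub>R v + Im c \<cdot>\<^sub>R (\<i> \<cdot> v)"
      by (metis complex_eq mult.commute scale_left_distrib scale_scale)
    then have "?f (c \<cdot> v) = complex_of_real (Re c) * ?f v + complex_of_real (Im c) * (\<i> * ?f v)"
      by (simp only: f_add f_rscale f_imult)
    also have "\<dots> = c * ?f v"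
      by (simp add: complex_eq_iff)
    finally show ?thesis .
  qed
  show ?thesis
    unfolding Vector_Spaces.linear_iff
    using f_add f_scale vector_space_axioms vector_space_over_itself.vector_space_axioms by blast
qed

lemma zero_mem_P: "0 \<in> P"
  using P_pointed by blast

end


section \<open>Cones that avoid the negative of the order unit\<close>

text \<open>The order unit is nonzero only because \<open>V \<noteq> {0}\<close>; without this there would be no states.\<close>

locale archimedean_star_vector_space = ordered_star_vector_space scl star P
  for scl :: "complex \<Rightarrow> 'v::ab_group_add \<Rightarrow> 'v" (infixr "\<cdot>" 75)
    and star :: "'v \<Rightarrow> 'v" and P :: "'v set" +
  fixes e :: 'v
  assumes arch_unit: "archimedean_order_unit scl star P e"
    and nontrivial: "(UNIV :: 'v set) \<noteq> {0}"
begin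

lemma e_hermitian: "e \<in> hermitian star"
  using arch_unit by (simp add: archimedean_order_unit_def order_unit_def)

lemma order_unit_bound:
  assumes "x \<in> hermitian star"
  obtains r where "r > 0" "r \<cdot>\<^sub>R e - x \<in> P"
  using arch_unit assms by (auto simp: archimedean_order_unit_def order_unit_def)

lemma archimedean:
  assumes "x \<in> hermitian star" "\<And>r. r > 0 \<Longrightarrow> r \<cdot>\<^sub>R e + x \<in> P"
  shows "x \<in> P"
  using arch_unit assms by (auto simp: archimedean_order_unit_def)

lemma e_mem_P: "e \<in> P"
proof -
  obtain r where r: "r > 0" "r \<cdot>\<^sub>R e - 0 \<in> P"
    using order_unit_bound hermitian_closed(1) by blast
  then have "(1/r) \<cdot>\<^sub>R (r \<cdot>\<^sub>R e) \<in> P"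
    using r by (intro P_scale[of "1/r"]) auto
  then show ?thesis
    using r by simp
qed

lemma e_nonzero: "e \<noteq> 0"
proof
  assume "e = 0"
  then have neg: "- x \<in> P" if "x \<in> hermitian star" for x
    using order_unit_bound[OF that] by (metis diff_0 scale_zero_right)
  have "x = 0" if "x \<in> hermitian star" for x
  proof -
    have "x \<in> P \<inter> uminus ` P"
      using neg[OF that] neg[OF hermitian_closed(4)[OF that]] by force
    then show ?thesis
      using P_pointed by simp
  qed
  then have "v = 0" for v :: 'v
    using cartesian_decomposition[of v] re_part_hermitian im_part_hermitian
    by (metis add_0 scale_zero_right)
  then show False
    using nontrivial by auto
qed

lemma neg_e_notin_P: "- e \<notin> P"
proof
  assume "- e \<in> P"
  then have "e \<in> P \<inter> uminus ` P"
    using e_mem_P by force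
  then show False
    using P_pointed e_nonzero by simp
qed

text \<open>A convex cone of hermitian vectors that contains \<open>P\<close> and is proper, in the sense that it
  avoids \<open>- e\<close>.  It need not be pointed: a proper cone may contain both \<open>x\<close> and \<open>- x\<close> for a
  nonzero \<open>x\<close>.\<close>

definition proper_cone :: "'v set \<Rightarrow> bool"
  where "proper_cone Q \<longleftrightarrow> P \<subseteq> Q \<and> Q \<subseteq> hermitian star \<and> - e \<notin> Q \<and>
    (\<forall>x\<in>Q. \<forall>y\<in>Q. x + y \<in> Q) \<and> (\<forall>r x. r \<ge> 0 \<longrightarrow> x \<in> Q \<longrightarrow> r \<cdot>\<^sub>R x \<in> Q)"

lemma proper_cone_P: "proper_cone P"
  using P_hermitian P_add P_scale neg_e_notin_P by (auto simp: proper_cone_def)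

text \<open>The convex cone generated by a convex cone \<open>Q\<close> and a vector \<open>x\<close>.\<close>

definition adjoin :: "'v set \<Rightarrow> 'v \<Rightarrow> 'v set"
  where "adjoin Q x = {q + r \<cdot>\<^sub>R x | q r. q \<in> Q \<and> r \<ge> 0}"

lemma subset_adjoin: "Q \<subseteq> adjoin Q x"
proof
  fix q assume "q \<in> Q"
  then have "q + 0 \<cdot>\<^sub>R x \<in> adjoin Q x"
    unfolding adjoin_def by blast
  then show "q \<in> adjoin Q x"
    by simp
qed

lemma mem_adjoin:
  assumes "proper_cone Q"
  shows "x \<in> adjoin Q x"
proof -
  have "0 \<in> Q" "(0 :: real) \<le> 1"
    using assms zero_mem_P by (auto simp: proper_cone_def)
  then have "0 + 1 \<cdot>\<^sub>R x \<in> adjoin Q x"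
    unfolding adjoin_def by blast
  then show ?thesis
    by simp
qed

lemma proper_cone_adjoin:
  assumes Q: "proper_cone Q" and x: "x \<in> hermitian star" and e: "- e \<notin> adjoin Q x"
  shows "proper_cone (adjoin Q x)"
proof -
  have "P \<subseteq> adjoin Q x"
    using Q subset_adjoin[of Q x] by (auto simp: proper_cone_def)
  moreover have "adjoin Q x \<subseteq> hermitian star"
    using Q x by (auto simp: adjoin_def proper_cone_def intro!: hermitian_closed)
  moreover have "a + b \<in> adjoin Q x" if "a \<in> adjoin Q x" "b \<in> adjoin Q x" for a b
  proof -
    obtain p r q s where "a = p + r \<cdot>\<^sub>R x" "b = q + s \<cdot>\<^sub>R x" "p \<in> Q" "q \<in> Q" "r \<ge> 0" "s \<ge> 0"
      using \<open>a \<in> adjoin Q x\<close> \<open>b \<in> adjoin Q x\<close> unfolding adjoin_def by blast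
    moreover from this have "a + b = (p + q) + (r + s) \<cdot>\<^sub>R x"
      by (simp add: algebra_simps)
    moreover have "p + q \<in> Q"
      using Q \<open>p \<in> Q\<close> \<open>q \<in> Q\<close> by (auto simp: proper_cone_def)
    ultimately show ?thesis
      unfolding adjoin_def by (smt (verit) mem_Collect_eq)
  qed
  moreover have "t \<cdot>\<^sub>R a \<in> adjoin Q x" if "t \<ge> 0" "a \<in> adjoin Q x" for t a
  proof -
    obtain p r where "a = p + r \<cdot>\<^sub>R x" "p \<in> Q" "r \<ge> 0"
      using \<open>a \<in> adjoin Q x\<close> unfolding adjoin_def by blast
    moreover from this have "t \<cdot>\<^sub>R a = t \<cdot>\<^sub>R p + (t * r) \<cdot>\<^sub>R x"
      by (simp add: algebra_simps)
    moreover have "t \<cdot>\<^sub>R p \<in> Q"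
      using Q \<open>p \<in> Q\<close> \<open>t \<ge> 0\<close> by (auto simp: proper_cone_def)
    moreover have "t * r \<ge> 0"
      using \<open>t \<ge> 0\<close> \<open>r \<ge> 0\<close> by simp
    ultimately show ?thesis
      unfolding adjoin_def by blast
  qed
  ultimately show ?thesis
    using e by (simp add: proper_cone_def)
qed

text \<open>A maximal proper cone defines a total preorder: if \<open>x\<close> cannot be adjoined then
  \<open>- e = q + r x\<close> for some \<open>q\<close> in the cone and \<open>r > 0\<close>, whence \<open>- x\<close> is a positive multiple of
  \<open>q + e\<close>.\<close>

lemma proper_cone_extends_to_total:
  assumes Q0: "proper_cone Q0"
  obtains Q where "proper_cone Q" "Q0 \<subseteq> Q" "\<And>x. x \<in> hermitian star \<Longrightarrow> x \<in> Q \<or> - x \<in> Q"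
proof -
  define \<A> where "\<A> = {Q. proper_cone Q \<and> Q0 \<subseteq> Q}"
  have "\<exists>M\<in>\<A>. \<forall>X\<in>\<A>. M \<subseteq> X \<longrightarrow> X = M"
  proof (rule subset_Zorn_nonempty)
    show "\<A> \<noteq> {}"
      using Q0 by (auto simp: \<A>_def)
  next
    fix \<C> assume ne: "\<C> \<noteq> {}" and chain: "subset.chain \<A> \<C>"
    have cone: "proper_cone C" "Q0 \<subseteq> C" if "C \<in> \<C>" for C
      using chain that by (auto simp: \<A>_def subset.chain_def)
    have add: "x + y \<in> \<Union>\<C>" if xy: "x \<in> \<Union>\<C>" "y \<in> \<Union>\<C>" for x y
    proof -
      obtain A B where AB: "A \<in> \<C>" "B \<in> \<C>" "x \<in> A" "y \<in> B"
        using xy by blast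
      then have "A \<subseteq> B \<or> B \<subseteq> A"
        using chain by (metis subset_chain_def)
      then obtain C where "C \<in> \<C>" "x \<in> C" "y \<in> C"
        using AB by blast
      moreover from this have "x + y \<in> C"
        using cone(1)[of C] by (simp add: proper_cone_def)
      ultimately show ?thesis
        by blast
    qed
    have "proper_cone (\<Union>\<C>)"
      unfolding proper_cone_def
    proof (intro conjI ballI allI impI)
      show "P \<subseteq> \<Union>\<C>"
        using ne cone(1) unfolding proper_cone_def by blast
      show "\<Union>\<C> \<subseteq> hermitian star"
        using cone(1) unfolding proper_cone_def by blast
      show "- e \<notin> \<Union>\<C>"
        using cone(1) unfolding proper_cone_def by blast
      show "x + y \<in> \<Union>\<C>" if "x \<in> \<Union>\<C>" "y \<in> \<Union>\<C>" for x y
        using add that .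
      show "r \<cdot>\<^sub>R x \<in> \<Union>\<C>" if "r \<ge> 0" "x \<in> \<Union>\<C>" for r x
        using cone(1) that unfolding proper_cone_def by blast
    qed
    moreover have "Q0 \<subseteq> \<Union>\<C>"
      using ne cone(2) by blast
    ultimately show "\<Union>\<C> \<in> \<A>"
      by (simp add: \<A>_def)
  qed
  then obtain Q where Q: "proper_cone Q" "Q0 \<subseteq> Q"
    and maximal: "\<And>R. proper_cone R \<Longrightarrow> Q \<subseteq> R \<Longrightarrow> R = Q"
    unfolding \<A>_def by (metis (mono_tags, lifting) mem_Collect_eq order_trans)
  have "x \<in> Q \<or> - x \<in> Q" if x: "x \<in> hermitian star" for x
  proof (rule disjCI)
    assume "- x \<notin> Q"
    have "- e \<notin> adjoin Q x"
    proof
      assume "- e \<in> adjoin Q x"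
      then obtain q r where qr: "- e = q + r \<cdot>\<^sub>R x" "q \<in> Q" "r \<ge> 0"
        unfolding adjoin_def by blast
      have "r \<noteq> 0"
        using qr Q(1) by (auto simp: proper_cone_def)
      have "q + e \<in> Q"
        using Q(1) qr(2) e_mem_P by (auto simp: proper_cone_def)
      moreover have "1/r \<ge> 0"
        using qr(3) by simp
      ultimately have "(1/r) \<cdot>\<^sub>R (q + e) \<in> Q"
        using Q(1) unfolding proper_cone_def by blast
      moreover have "q = - e - r \<cdot>\<^sub>R x"
        using qr(1) by simp
      then have "q + e = - (r \<cdot>\<^sub>R x)"
        by simp
      then have "(1/r) \<cdot>\<^sub>R (q + e) = - x"
        using \<open>r \<noteq> 0\<close> by simp
      ultimately show False
        using \<open>- x \<notin> Q\<close> by simp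
    qed
    then have "adjoin Q x = Q"
      using maximal proper_cone_adjoin[OF Q(1) x] subset_adjoin by blast
    then show "x \<in> Q"
      using mem_adjoin[OF Q(1)] by blast
  qed
  then show thesis
    using that Q by blast
qed


section \<open>Existence of states\<close>

text \<open>A total proper cone \<open>Q\<close> determines a real functional \<open>g\<close>: its value at \<open>x\<close> is the
  supremum of the half-line \<open>{t. x - t e \<in> Q}\<close>, which is nonempty and bounded above because \<open>e\<close>
  is an order unit and \<open>- e \<notin> Q\<close>.  Superadditivity is clear; totality gives
  \<open>g (- x) = - g x\<close>, and the two together give additivity.\<close>

lemma total_cone_functional:
  assumes Q: "proper_cone Q" and total: "\<And>x. x \<in> hermitian star \<Longrightarrow> x \<in> Q \<or> - x \<in> Q"
  obtains g :: "'v \<Rightarrow> real" where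
    "\<And>x y. x \<in> hermitian star \<Longrightarrow> y \<in> hermitian star \<Longrightarrow> g (x + y) = g x + g y"
    "\<And>r x. x \<in> hermitian star \<Longrightarrow> g (r \<cdot>\<^sub>R x) = r * g x"
    "\<And>x. x \<in> Q \<Longrightarrow> g x \<ge> 0"
    "g e = 1"
proof -
  have Q_add: "x + y \<in> Q" if "x \<in> Q" "y \<in> Q" for x y
    using Q that by (auto simp: proper_cone_def)
  have Q_scale: "r \<cdot>\<^sub>R x \<in> Q" if "r \<ge> 0" "x \<in> Q" for r x
    using Q that by (auto simp: proper_cone_def)
  have P_Q: "P \<subseteq> Q" and Q_herm: "Q \<subseteq> hermitian star" and ne_Q: "- e \<notin> Q"
    using Q by (auto simp: proper_cone_def)
  have e_mult: "t \<cdot>\<^sub>R e \<in> Q \<longleftrightarrow> t \<ge> 0" for t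
  proof
    assume t: "t \<cdot>\<^sub>R e \<in> Q"
    show "t \<ge> 0"
    proof (rule ccontr)
      assume "\<not> t \<ge> 0"
      then have "(1 / - t) \<cdot>\<^sub>R (t \<cdot>\<^sub>R e) \<in> Q"
        by (intro Q_scale t) auto
      moreover have "(1 / - t) \<cdot>\<^sub>R (t \<cdot>\<^sub>R e) = - e"
        using \<open>\<not> t \<ge> 0\<close> by simp
      ultimately show False
        using ne_Q by simp
    qed
  qed (use Q_scale e_mem_P P_Q in blast)
  define L where "L x = {t. x - t \<cdot>\<^sub>R e \<in> Q}" for x
  define g where "g x = Sup (L x)" for x
  have L_nonempty: "L x \<noteq> {}" if x: "x \<in> hermitian star" for x
  proof -
    obtain r where "r \<cdot>\<^sub>R e - (- x) \<in> P"
      using order_unit_bound hermitian_closed(4)[OF x] by blast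
    then have "- r \<in> L x"
      using P_Q by (auto simp: L_def add.commute)
    then show ?thesis
      by blast
  qed
  have L_bdd: "bdd_above (L x)" if x: "x \<in> hermitian star" for x
  proof -
    obtain r where r: "r \<cdot>\<^sub>R e - x \<in> P"
      using order_unit_bound x by blast
    have "t \<le> r" if "t \<in> L x" for t
    proof -
      have "(r \<cdot>\<^sub>R e - x) + (x - t \<cdot>\<^sub>R e) \<in> Q"
        using that r P_Q by (intro Q_add) (auto simp: L_def)
      then have "(r - t) \<cdot>\<^sub>R e \<in> Q"
        by (simp add: algebra_simps)
      then show ?thesis
        using e_mult[of "r - t"] by simp
    qed
    then show ?thesis
      by (meson bdd_above.I)
  qed
  have L_le: "t \<le> g x" if "t \<in> L x" "x \<in> hermitian star" for t x
    using that L_bdd unfolding g_def by (intro cSup_upper) auto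
  have g_nonneg: "g x \<ge> 0" if "x \<in> Q" for x
    using that Q_herm by (intro L_le) (auto simp: L_def)
  have L_e: "L (r \<cdot>\<^sub>R e) = {..r}" for r
    using e_mult[of "r - _"] by (auto simp: L_def algebra_simps)
  have g_e: "g (r \<cdot>\<^sub>R e) = r" for r
    by (simp add: g_def L_e)
  have superadditive: "g x + g y \<le> g (x + y)"
    if x: "x \<in> hermitian star" and y: "y \<in> hermitian star" for x y
  proof -
    have sum: "s + t \<le> g (x + y)" if "s \<in> L x" "t \<in> L y" for s t
    proof (rule L_le)
      have "(x - s \<cdot>\<^sub>R e) + (y - t \<cdot>\<^sub>R e) \<in> Q"
        using that by (intro Q_add) (auto simp: L_def)
      then show "s + t \<in> L (x + y)"
        by (simp add: L_def algebra_simps)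
      show "x + y \<in> hermitian star"
        using x y by (rule hermitian_closed)
    qed
    have "g x \<le> g (x + y) - t" if t: "t \<in> L y" for t
      unfolding g_def[of x]
    proof (rule cSup_least)
      show "s \<le> g (x + y) - t" if "s \<in> L x" for s
        using sum[OF that t] by simp
    qed (use L_nonempty x in simp)
    then have "g y \<le> g (x + y) - g x"
      unfolding g_def[of y] by (intro cSup_least) (use L_nonempty y in force)+
    then show ?thesis
      by simp
  qed
  have g_minus: "g (- x) = - g x" if x: "x \<in> hermitian star" for x
  proof (rule antisym)
    show "g (- x) \<le> - g x"
      using superadditive[OF x hermitian_closed(4)[OF x]] g_e[of 0] by simp
    show "- g x \<le> g (- x)"
    proof (rule field_le_epsilon)
      fix \<epsilon> :: real assume "\<epsilon> > 0"
      define t where "t = g x + \<epsilon>"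
      have "t \<notin> L x"
        using L_le[OF _ x, of t] \<open>\<epsilon> > 0\<close> by (auto simp: t_def)
      then have "- (x - t \<cdot>\<^sub>R e) \<in> Q"
        using total[of "x - t \<cdot>\<^sub>R e"] x e_hermitian by (auto simp: L_def intro!: hermitian_closed)
      then have "- t \<in> L (- x)"
        by (simp add: L_def)
      then show "- g x \<le> g (- x) + \<epsilon>"
        using L_le[OF _ hermitian_closed(4)[OF x], of "- t"] by (simp add: t_def)
    qed
  qed
  have g_add: "g (x + y) = g x + g y"
    if x: "x \<in> hermitian star" and y: "y \<in> hermitian star" for x y
  proof (rule antisym)
    have "g (- x) + g (- y) \<le> g (- x + - y)"
      using x y by (intro superadditive hermitian_closed)
    also have "- x + - y = - (x + y)"
      by simp
    finally show "g (x + y) \<le> g x + g y"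
      unfolding g_minus[OF x] g_minus[OF y] g_minus[OF hermitian_closed(2)[OF x y]] by simp
  qed (rule superadditive[OF x y])
  have g_pos_scale: "g (r \<cdot>\<^sub>R x) \<ge> r * g x" if x: "x \<in> hermitian star" and r: "r > 0" for r x
  proof -
    have "g x \<le> g (r \<cdot>\<^sub>R x) / r"
      unfolding g_def[of x]
    proof (rule cSup_least)
      fix t assume "t \<in> L x"
      then have "r \<cdot>\<^sub>R (x - t \<cdot>\<^sub>R e) \<in> Q"
        using r by (intro Q_scale) (auto simp: L_def)
      then have "r * t \<in> L (r \<cdot>\<^sub>R x)"
        by (simp add: L_def algebra_simps)
      then have "r * t \<le> g (r \<cdot>\<^sub>R x)"
        using x by (intro L_le hermitian_closed)
      then show "t \<le> g (r \<cdot>\<^sub>R x) / r"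
        using r by (simp add: field_simps)
    qed (use L_nonempty x in simp)
    then show ?thesis
      using r by (simp add: field_simps)
  qed
  have g_scale_pos: "g (r \<cdot>\<^sub>R x) = r * g x" if x: "x \<in> hermitian star" and r: "r > 0" for r x
  proof (rule antisym)
    \<comment> \<open>the reverse inequality is the same one for \<open>1/r\<close> and \<open>r x\<close>\<close>
    have "(1/r) * g (r \<cdot>\<^sub>R x) \<le> g ((1/r) \<cdot>\<^sub>R (r \<cdot>\<^sub>R x))"
      using x r by (intro g_pos_scale hermitian_closed) auto
    then show "g (r \<cdot>\<^sub>R x) \<le> r * g x"
      using r by (simp add: field_simps)
  qed (rule g_pos_scale[OF x r])
  have g_scale: "g (r \<cdot>\<^sub>R x) = r * g x" if x: "x \<in> hermitian star" for r x
  proof (cases r "0 :: real" rule: linorder_cases)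
    case less
    then have "g ((- r) \<cdot>\<^sub>R x) = - r * g x"
      using g_scale_pos[OF x, of "- r"] by simp
    then show ?thesis
      using g_minus[OF hermitian_closed(5)[OF x], of r] by simp
  next
    case equal
    then show ?thesis
      using g_e[of 0] by simp
  next
    case greater
    then show ?thesis
      using g_scale_pos[OF x] by simp
  qed
  show thesis
    using that[of g] g_add g_scale g_nonneg g_e[of 1] by simp
qed

text \<open>The Archimedean property is used once, here: it yields a multiple \<open>r e\<close> that can be added to
  \<open>v\<close> without making it positive, which turns the inequality \<open>f v \<le> 0\<close> into a strict one.\<close>

lemma exists_negative_state:
  assumes v: "v \<in> hermitian star" "v \<notin> P"
  obtains f s where "f \<in> state_space scl P e" "s < 0" "f v = complex_of_real s"
proof -
  obtain r where r: "r > 0" "r \<cdot>\<^sub>R e + v \<notin> P"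
    using archimedean v by blast
  define w where "w = r \<cdot>\<^sub>R e + v"
  have w: "w \<in> hermitian star"
    using v(1) e_hermitian by (auto simp: w_def intro!: hermitian_closed)
  have "- e \<notin> adjoin P (- w)"
  proof
    assume "- e \<in> adjoin P (- w)"
    then obtain p t where pt: "- e = p + t \<cdot>\<^sub>R (- w)" "p \<in> P" "t \<ge> 0"
      unfolding adjoin_def by blast
    have "t \<noteq> 0"
      using pt neg_e_notin_P by auto
    have "t \<cdot>\<^sub>R w = p + e"
      using pt(1) by (simp add: algebra_simps minus_equation_iff)
    then have "(1/t) \<cdot>\<^sub>R (t \<cdot>\<^sub>R w) \<in> P"
      using pt e_mem_P P_add by (intro P_scale[of "1/t"]) auto
    then show False
      using r(2) \<open>t \<noteq> 0\<close> by (simp add: w_def)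
  qed
  then have "proper_cone (adjoin P (- w))"
    using w by (intro proper_cone_adjoin proper_cone_P hermitian_closed)
  then obtain Q where Q: "proper_cone Q" "adjoin P (- w) \<subseteq> Q"
    and total: "\<And>x. x \<in> hermitian star \<Longrightarrow> x \<in> Q \<or> - x \<in> Q"
    using proper_cone_extends_to_total by blast
  obtain g :: "'v \<Rightarrow> real" where
    g_add: "\<And>x y. x \<in> hermitian star \<Longrightarrow> y \<in> hermitian star \<Longrightarrow> g (x + y) = g x + g y"
    and g_scale: "\<And>r x. x \<in> hermitian star \<Longrightarrow> g (r \<cdot>\<^sub>R x) = r * g x"
    and g_nonneg: "\<And>x. x \<in> Q \<Longrightarrow> g x \<ge> 0"
    and g_e: "g e = 1"
    using total_cone_functional[OF Q(1) total] by metis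
  define f where "f x = Complex (g (re_part x)) (g (im_part x))" for x
  have f_herm: "f x = complex_of_real (g x)" if "x \<in> hermitian star" for x
    using g_scale[OF hermitian_closed(1), of 0] that
    by (simp add: f_def re_part_id im_part_zero complex_eq_iff)
  have "Vector_Spaces.linear scl (*) f"
    unfolding f_def by (rule complexification_linear[OF g_add g_scale])
  moreover have "f x \<in> \<real>\<^sub>\<ge>\<^sub>0" if "x \<in> P" for x
  proof -
    have "x \<in> hermitian star" "x \<in> Q"
      using that Q(1) P_hermitian by (auto simp: proper_cone_def)
    then show ?thesis
      using f_herm g_nonneg by simp
  qed
  ultimately have "f \<in> state_space scl P e"
    using f_herm[OF e_hermitian] g_e by (auto simp: state_space_def)
  moreover have "g v < 0"
  proof -
    have "- w \<in> Q"
      using mem_adjoin[OF proper_cone_P] Q(2) by blast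
    then have "g (- w) \<ge> 0"
      by (rule g_nonneg)
    then have "g w \<le> 0"
      using g_scale[OF w, of "- 1"] by simp
    moreover have "g w = r + g v"
      using g_add[OF hermitian_closed(5)[OF e_hermitian, of r] v(1)] g_scale[OF e_hermitian, of r] g_e
      by (simp add: w_def)
    ultimately show ?thesis
      using r(1) by simp
  qed
  ultimately show thesis
    using that f_herm[OF v(1)] by blast
qed


section \<open>States separate points and detect positivity\<close>

lemma state_linear:
  assumes "f \<in> state_space scl P e"
  shows "f (x + y) = f x + f y" "f (c \<cdot> x) = c * f x" "f (x - y) = f x - f y" "f 0 = 0"
proof -
  show add: "f (x + y) = f x + f y" and scale: "f (c \<cdot> x) = c * f x" for x y c
    using assms by (auto simp: state_space_def Vector_Spaces.linear_iff)
  show "f (x - y) = f x - f y"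
    using add[of "x - y" y] by simp
  show "f 0 = 0"
    using add[of 0 0] by simp
qed

lemma state_nonneg: "f \<in> state_space scl P e \<Longrightarrow> x \<in> P \<Longrightarrow> f x \<in> \<real>\<^sub>\<ge>\<^sub>0"
  by (auto simp: state_space_def)

lemma state_e: "f \<in> state_space scl P e \<Longrightarrow> f e = 1"
  by (auto simp: state_space_def)

text \<open>A state is real on hermitian vectors because each of them is a difference of the positive
  vectors \<open>r e\<close> and \<open>r e - x\<close>.\<close>

lemma state_real:
  assumes f: "f \<in> state_space scl P e" and x: "x \<in> hermitian star"
  shows "f x \<in> \<real>"
proof -
  obtain r where "r \<cdot>\<^sub>R e - x \<in> P"
    using order_unit_bound x by blast
  then have "f (r \<cdot>\<^sub>R e - x) \<in> \<real>\<^sub>\<ge>\<^sub>0"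
    using f by (rule state_nonneg[rotated])
  then have "complex_of_real r - f x \<in> \<real>"
    using f by (auto simp: state_linear state_e elim: nonneg_Reals_cases)
  then have "complex_of_real r - (complex_of_real r - f x) \<in> \<real>"
    by (rule Reals_diff[OF Reals_of_real])
  then show ?thesis
    by simp
qed

lemma state_cartesian:
  assumes f: "f \<in> state_space scl P e"
  shows "f (re_part v) = complex_of_real (Re (f v))" "f (im_part v) = complex_of_real (Im (f v))"
proof -
  have "f v = f (re_part v) + \<i> * f (im_part v)"
    using arg_cong[OF cartesian_decomposition[of v], of f] f by (simp add: state_linear)
  moreover obtain a b where "f (re_part v) = complex_of_real a" "f (im_part v) = complex_of_real b"
    using state_real[OF f re_part_hermitian] state_real[OF f im_part_hermitian]
    by (metis Reals_cases)
  ultimately show "f (re_part v) = complex_of_real (Re (f v))"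
      "f (im_part v) = complex_of_real (Im (f v))"
    by simp_all
qed

lemma hermitian_positive_if_states:
  assumes "x \<in> hermitian star" "\<And>f. f \<in> state_space scl P e \<Longrightarrow> f x \<in> \<real>\<^sub>\<ge>\<^sub>0"
  shows "x \<in> P"
proof (rule ccontr)
  assume "x \<notin> P"
  then obtain f s where "f \<in> state_space scl P e" "s < 0" "f x = complex_of_real s"
    using exists_negative_state assms(1) by blast
  then show False
    using assms(2)[of f] by simp
qed

lemma states_separate:
  assumes "\<And>f. f \<in> state_space scl P e \<Longrightarrow> f v = 0"
  shows "v = 0"
proof -
  have herm: "x = 0" if x: "x \<in> hermitian star" "\<And>f. f \<in> state_space scl P e \<Longrightarrow> f x = 0" for x
  proof -
    have "x \<in> P"
    proof (rule hermitian_positive_if_states)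
      show "f x \<in> \<real>\<^sub>\<ge>\<^sub>0" if "f \<in> state_space scl P e" for f
        using x(2)[OF that] by simp
    qed (rule x(1))
    moreover have "- x \<in> P"
    proof (rule hermitian_positive_if_states)
      show "f (- x) \<in> \<real>\<^sub>\<ge>\<^sub>0" if "f \<in> state_space scl P e" for f
        using state_linear(3)[OF that, of 0 x] state_linear(4)[OF that] x(2)[OF that] by simp
    qed (use x hermitian_closed in blast)
    ultimately have "x \<in> P \<inter> uminus ` P"
      by force
    then show ?thesis
      using P_pointed by simp
  qed
  have "re_part v = 0"
    by (rule herm[OF re_part_hermitian]) (simp add: state_cartesian assms)
  moreover have "im_part v = 0"
    by (rule herm[OF im_part_hermitian]) (simp add: state_cartesian assms)
  ultimately show ?thesis
    using cartesian_decomposition[of v] by simp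
qed

lemma positive_iff_states: "v \<in> P \<longleftrightarrow> (\<forall>f\<in>state_space scl P e. f v \<in> \<real>\<^sub>\<ge>\<^sub>0)"
proof
  assume pos: "\<forall>f\<in>state_space scl P e. f v \<in> \<real>\<^sub>\<ge>\<^sub>0"
  have "im_part v = 0"
  proof (rule states_separate)
    show "f (im_part v) = 0" if "f \<in> state_space scl P e" for f
      using that pos state_cartesian(2)[OF that] by (auto simp: complex_nonneg_Reals_iff)
  qed
  then have "v = re_part v"
    using cartesian_decomposition[of v] by simp
  then have "v \<in> hermitian star"
    using re_part_hermitian by metis
  then show "v \<in> P"
    using pos by (intro hermitian_positive_if_states) auto
qed (auto intro: state_nonneg)

lemma state_space_nonempty: "state_space scl P e \<noteq> {}"
  using exists_negative_state[OF hermitian_closed(4)[OF e_hermitian] neg_e_notin_P] by blast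


section \<open>The minimal order norm and the order topology\<close>

lemma hermitian_state_bound:
  assumes x: "x \<in> hermitian star"
  obtains B where "\<And>f. f \<in> state_space scl P e \<Longrightarrow> cmod (f x) \<le> B"
proof -
  obtain r where r: "r > 0" "r \<cdot>\<^sub>R e - x \<in> P"
    using order_unit_bound x by blast
  obtain s where s: "s > 0" "s \<cdot>\<^sub>R e - (- x) \<in> P"
    using order_unit_bound hermitian_closed(4)[OF x] by blast
  have "cmod (f x) \<le> max r s" if f: "f \<in> state_space scl P e" for f
  proof -
    obtain a where a: "f x = complex_of_real a"
      using state_real[OF f x] by (metis Reals_cases)
    have "complex_of_real (r - a) \<in> \<real>\<^sub>\<ge>\<^sub>0"
      using state_nonneg[OF f r(2)] f by (simp add: state_linear state_e a)
    moreover have "complex_of_real (s + a) \<in> \<real>\<^sub>\<ge>\<^sub>0"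
      using state_nonneg[OF f s(2)] f by (simp add: state_linear state_e a)
    ultimately have "a \<le> r" "- a \<le> s"
      unfolding nonneg_Reals_of_real_iff by simp_all
    then show ?thesis
      by (simp add: a abs_le_iff max_def)
  qed
  then show thesis
    using that by blast
qed

lemma bdd_above_states: "bdd_above ((\<lambda>f. cmod (f v)) ` state_space scl P e)"
proof -
  obtain A where A: "\<And>f. f \<in> state_space scl P e \<Longrightarrow> cmod (f (re_part v)) \<le> A"
    using hermitian_state_bound re_part_hermitian by blast
  obtain B where B: "\<And>f. f \<in> state_space scl P e \<Longrightarrow> cmod (f (im_part v)) \<le> B"
    using hermitian_state_bound im_part_hermitian by blast
  have "cmod (f v) \<le> A + B" if f: "f \<in> state_space scl P e" for f
    using cmod_le[of "f v"] A[OF f] B[OF f] by (simp add: state_cartesian[OF f])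
  then show ?thesis
    by (meson bdd_aboveI2)
qed

abbreviation order_norm :: "'v \<Rightarrow> real" ("\<parallel>_\<parallel>")
  where "\<parallel>v\<parallel> \<equiv> min_order_norm scl P e v"

lemma state_le_norm: "f \<in> state_space scl P e \<Longrightarrow> cmod (f v) \<le> \<parallel>v\<parallel>"
  unfolding min_order_norm_def by (rule cSUP_upper[OF _ bdd_above_states])

lemma norm_leI: "(\<And>f. f \<in> state_space scl P e \<Longrightarrow> cmod (f v) \<le> B) \<Longrightarrow> \<parallel>v\<parallel> \<le> B"
  unfolding min_order_norm_def by (rule cSUP_least[OF state_space_nonempty])

lemma norm_nonneg: "\<parallel>v\<parallel> \<ge> 0"
  using state_space_nonempty state_le_norm by (metis ex_in_conv norm_ge_zero order_trans)

text \<open>Definiteness of the norm is separation of points by states.\<close>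

sublocale order_metric: Metric_space UNIV "\<lambda>x y. \<parallel>x - y\<parallel>"
proof
  fix x y z :: 'v
  show "0 \<le> \<parallel>x - y\<parallel>"
    by (rule norm_nonneg)
  show "\<parallel>x - y\<parallel> = \<parallel>y - x\<parallel>"
    unfolding min_order_norm_def
    by (rule SUP_cong) (auto simp: state_linear norm_minus_commute)
  show "\<parallel>x - y\<parallel> = 0 \<longleftrightarrow> x = y"
  proof
    assume "\<parallel>x - y\<parallel> = 0"
    then have "x - y = 0"
      using state_le_norm[of _ "x - y"] by (intro states_separate) force
    then show "x = y"
      by simp
  next
    assume "x = y"
    then have "\<parallel>x - y\<parallel> \<le> 0"
      by (intro norm_leI) (simp add: state_linear)
    then show "\<parallel>x - y\<parallel> = 0"
      using norm_nonneg[of "x - y"] by simp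
  qed
  show "\<parallel>x - z\<parallel> \<le> \<parallel>x - y\<parallel> + \<parallel>y - z\<parallel>"
  proof (rule norm_leI)
    fix f assume f: "f \<in> state_space scl P e"
    have "f (x - z) = f (x - y) + f (y - z)"
      using f by (simp add: state_linear)
    then have "cmod (f (x - z)) \<le> cmod (f (x - y)) + cmod (f (y - z))"
      by (metis norm_triangle_ineq)
    then show "cmod (f (x - z)) \<le> \<parallel>x - y\<parallel> + \<parallel>y - z\<parallel>"
      using state_le_norm[OF f, of "x - y"] state_le_norm[OF f, of "y - z"] by simp
  qed
qed

lemma state_continuous:
  assumes f: "f \<in> state_space scl P e"
  shows "continuous_map (order_norm_topology scl P e) euclidean f"
proof -
  have "continuous_map order_metric.mtopology Met_TC.mtopology f"
    unfolding Met_TC.continuous_map_to_metric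
  proof (intro ballI allI impI)
    fix x and \<epsilon> :: real assume "\<epsilon> > 0"
    have "dist (f x) (f y) < \<epsilon>" if "y \<in> order_metric.mball x \<epsilon>" for y
      using that state_le_norm[OF f, of "x - y"] f by (simp add: dist_norm state_linear)
    then show "\<exists>U. openin order_metric.mtopology U \<and> x \<in> U \<and> (\<forall>y\<in>U. f y \<in> Met_TC.mball (f x) \<epsilon>)"
      using \<open>\<epsilon> > 0\<close> order_metric.zero[of x x] by (intro exI[of _ "order_metric.mball x \<epsilon>"]) auto
  qed
  then show ?thesis
    by (simp add: order_norm_topology_def)
qed


section \<open>The state space and the evaluation map\<close>

text \<open>Intersecting with the topological dual changes nothing, since states are continuous.\<close>

lemma state_topology_eq:
  "state_topology scl P e = subtopology (product_topology (\<lambda>_. euclidean) UNIV) (state_space scl P e)"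
proof -
  have "state_space scl P e \<subseteq> topological_dual scl (order_norm_topology scl P e)"
    using state_continuous by (auto simp: topological_dual_def state_space_def)
  then show ?thesis
    by (simp add: state_topology_def weak_star_topology_def subtopology_subtopology
        Int_absorb1)
qed

lemma topspace_state_topology: "topspace (state_topology scl P e) = state_space scl P e"
  by (simp add: state_topology_eq)

lemma closed_state_space: "closed (state_space scl P e)"
proof -
  have "state_space scl P e =
      (\<Inter>x y. {f. f (x + y) = f x + f y}) \<inter> (\<Inter>c x. {f. f (c \<cdot> x) = c * f x}) \<inter>
      (\<Inter>x\<in>P. {f. f x \<in> \<real>\<^sub>\<ge>\<^sub>0}) \<inter> {f. f e = 1}"
    using vector_space_axioms vector_space_over_itself.vector_space_axioms
    by (auto simp: state_space_def Vector_Spaces.linear_iff)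
  moreover have "closed {f :: 'v \<Rightarrow> complex. f x \<in> \<real>\<^sub>\<ge>\<^sub>0}" for x
    using closed_vimage[OF closed_nonneg_Reals_complex continuous_on_product_coordinates[of x]]
    by (simp add: vimage_def)
  ultimately show ?thesis
    by (auto intro!: closed_Int closed_INT closed_Collect_eq continuous_intros
        continuous_on_product_coordinates)
qed

lemma compact_state_topology: "compact_space (state_topology scl P e)"
proof -
  have "compactin (product_topology (\<lambda>_. euclidean) UNIV) (state_space scl P e)"
  proof (rule closed_compactin)
    show "compactin (product_topology (\<lambda>_. euclidean) UNIV) (\<Pi>\<^sub>E v\<in>UNIV. cball (0 :: complex) \<parallel>v\<parallel>)"
      by (simp add: compactin_PiE)
    show "state_space scl P e \<subseteq> (\<Pi>\<^sub>E v\<in>UNIV. cball 0 \<parallel>v\<parallel>)"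
      using state_le_norm by auto
    show "closedin (product_topology (\<lambda>_. euclidean) UNIV) (state_space scl P e)"
      using closed_state_space by (simp add: euclidean_product_topology)
  qed
  then show ?thesis
    unfolding state_topology_eq by (rule compact_space_subtopology)
qed

lemma Hausdorff_state_topology: "Hausdorff_space (state_topology scl P e)"
  unfolding state_topology_eq
  by (intro Hausdorff_space_subtopology) (simp add: Hausdorff_space_product_topology)

lemma evaluation_map_in_C_space: "evaluation_map scl P e v \<in> C_space (state_topology scl P e)"
proof -
  have "continuous_map (state_topology scl P e) euclidean (\<lambda>f. f v)"
    unfolding state_topology_eq
    by (intro continuous_map_from_subtopology continuous_map_product_projection) simp
  then have "continuous_map (state_topology scl P e) euclidean (evaluation_map scl P e v)"
    by (rule continuous_map_eq) (simp add: evaluation_map_def topspace_state_topology)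
  then show ?thesis
    by (simp add: C_space_def topspace_state_topology evaluation_map_def)
qed

lemma inj_evaluation_map: "inj (evaluation_map scl P e)"
proof (rule injI)
  fix v w assume eq: "evaluation_map scl P e v = evaluation_map scl P e w"
  have "f (v - w) = 0" if "f \<in> state_space scl P e" for f
    using fun_cong[OF eq, of f] that by (simp add: evaluation_map_def state_linear)
  then have "v - w = 0"
    by (rule states_separate)
  then show "v = w"
    by simp
qed

lemma order_iso_evaluation_map:
  "order_iso_onto_range scl P (state_topology scl P e) (evaluation_map scl P e)"
proof -
  have "linear_into_C scl (state_topology scl P e) (evaluation_map scl P e)"
    by (auto simp: linear_into_C_def topspace_state_topology evaluation_map_def state_linear
        intro!: restrict_ext)
  moreover have "v \<in> P \<longleftrightarrow> evaluation_map scl P e v \<in> C_pos (state_topology scl P e)" for v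
    using evaluation_map_in_C_space
    by (simp add: positive_iff_states[of v] C_pos_def topspace_state_topology)
      (simp add: evaluation_map_def)
  ultimately show ?thesis
    using inj_evaluation_map by (simp add: order_iso_onto_range_def inj_on_imp_bij_betw)
qed

lemma evaluation_map_e: "evaluation_map scl P e e = C_one (state_topology scl P e)"
  by (auto simp: evaluation_map_def C_one_def topspace_state_topology state_e intro!: restrict_ext)

lemma evaluation_map_isometry:
  "sup_norm (state_topology scl P e) (evaluation_map scl P e v) = \<parallel>v\<parallel>"
  by (simp add: sup_norm_def min_order_norm_def topspace_state_topology evaluation_map_def)

end


section \<open>The representation theorem\<close>

theorem theorem5p2:
  fixes scl :: "complex \<Rightarrow> 'v::ab_group_add \<Rightarrow> 'v"
    and star :: "'v \<Rightarrow> 'v" and P :: "'v set" and e :: 'v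
  assumes "ordered_star_vector_space scl star P"
    and "archimedean_order_unit scl star P e"
    and "(UNIV :: 'v set) \<noteq> {0}"
  defines "X \<equiv> state_topology scl P e"
    and "\<Phi> \<equiv> evaluation_map scl P e"
  shows "topspace X = state_space scl P e \<and> compact_space X \<and> Hausdorff_space X \<and>
    \<Phi> \<in> UNIV \<rightarrow> C_space X \<and>
    inj \<Phi> \<and>
    order_iso_onto_range scl P X \<Phi> \<and>
    \<Phi> e = C_one X \<and>
    (\<forall>v. sup_norm X (\<Phi> v) = min_order_norm scl P e v)"
proof -
  interpret archimedean_star_vector_space scl star P e
    using assms(1-3) by (simp add: archimedean_star_vector_space_def
        archimedean_star_vector_space_axioms_def)
  show ?thesis
    unfolding X_def \<Phi>_def
    using topspace_state_topology compact_state_topology Hausdorff_state_topology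
      evaluation_map_in_C_space inj_evaluation_map order_iso_evaluation_map evaluation_map_e
      evaluation_map_isometry
    by blast
qed

end
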